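(* Let $\ell,m,n$ be positive integers. Let $N$ be a compact $C^2$ manifold of dimension $n$. Let $f:N\to U$ be a $C^2$ embedding of $N$ into an open subset $U$ of $\mathbb{R}^m$. Let $F:U\to\mathbb{R}^\ell$ be a $C^2$ mapping. If $\ell>2n$, then there exists a subset $\Sigma$ of $\mathcal{L}(\mathbb{R}^m,\mathbb{R}^\ell)$ with Lebesgue measure zero such that for any $\pi\in\mathcal{L}(\mathbb{R}^m,\mathbb{R}^\ell)-\Sigma$, the $C^2$ mapping $F_\pi\circ f:N\to\mathbb{R}^\ell$ is an embedding.
   Context: All manifolds are without boundary and have countable bases. $\mathcal{L}(\mathbb{R}^m,\mathbb{R}^\ell)$ is the space of all linear mappings $\mathbb{R}^m\to\mathbb{R}^\ell$, naturally identified with $(\mathbb{R}^m)^\ell$, which gives the meaning of Lebesgue measure zero. For $\pi\in\mathcal{L}(\mathbb{R}^m,\mathbb{R}^\ell)$, $F_\pi=F+\pi|_U:U\to\mathbb{R}^\ell$. *)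

theory Defs
  imports "HOL-Analysis.Analysis"
begin

(* Twice continuously Frechet differentiable, meant for open S only; f1 and f2 are the first and
   second derivatives. *)
definition C2_on ::
  "('a::real_normed_vector \<Rightarrow> 'b::real_normed_vector) \<Rightarrow> 'a set \<Rightarrow> bool" where
  "C2_on f S \<longleftrightarrow>
    (\<exists>(f1 :: 'a \<Rightarrow> 'a \<Rightarrow>\<^sub>L 'b) (f2 :: 'a \<Rightarrow> 'a \<Rightarrow>\<^sub>L ('a \<Rightarrow>\<^sub>L 'b)).
      (\<forall>x\<in>S. (f has_derivative blinfun_apply (f1 x)) (at x)) \<and>
      (\<forall>x\<in>S. (f1 has_derivative blinfun_apply (f2 x)) (at x)) \<and>
      continuous_on S f2)"

type_synonym ('a, 'n) chart = "'a set \<times> ('a \<Rightarrow> real^'n)"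

(* The inverse of a chart (V, \<phi>) is inv_into V \<phi>, since \<phi> is only relevant on V. *)
definition is_chart :: "'a topology \<Rightarrow> ('a, 'n::finite) chart \<Rightarrow> bool" where
  "is_chart X = (\<lambda>(V, \<phi>). openin X V \<and> open (\<phi> ` V) \<and>
     homeomorphic_map (subtopology X V) (top_of_set (\<phi> ` V)) \<phi>)"

(* The C2 structure is the one generated by the atlas A, which need not be maximal. *)
definition C2_manifold :: "'a topology \<Rightarrow> ('a, 'n::finite) chart set \<Rightarrow> bool" where
  "C2_manifold X A \<longleftrightarrow>
    Hausdorff_space X \<and> second_countable X \<and>
    (\<forall>c\<in>A. is_chart X c) \<and> (\<Union>(V, \<phi>)\<in>A. V) = topspace X \<and>
    (\<forall>(V, \<phi>)\<in>A. \<forall>(W, \<psi>)\<in>A. C2_on (\<psi> \<circ> inv_into V \<phi>) (\<phi> ` (V \<inter> W)))"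

definition C2_map ::
  "'a topology \<Rightarrow> ('a, 'n::finite) chart set \<Rightarrow> (real^'m) set \<Rightarrow> ('a \<Rightarrow> real^'m) \<Rightarrow> bool" where
  "C2_map X A U f \<longleftrightarrow>
    f ` topspace X \<subseteq> U \<and> (\<forall>(V, \<phi>)\<in>A. C2_on (f \<circ> inv_into V \<phi>) (\<phi> ` V))"

definition C2_immersion ::
  "'a topology \<Rightarrow> ('a, 'n::finite) chart set \<Rightarrow> (real^'m) set \<Rightarrow> ('a \<Rightarrow> real^'m) \<Rightarrow> bool" where
  "C2_immersion X A U f \<longleftrightarrow> C2_map X A U f \<and>
    (\<forall>(V, \<phi>)\<in>A. \<forall>p\<in>V. inj (frechet_derivative (f \<circ> inv_into V \<phi>) (at (\<phi> p))))"

definition C2_embedding ::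
  "'a topology \<Rightarrow> ('a, 'n::finite) chart set \<Rightarrow> (real^'m) set \<Rightarrow> ('a \<Rightarrow> real^'m) \<Rightarrow> bool" where
  "C2_embedding X A U f \<longleftrightarrow> C2_immersion X A U f \<and> embedding_map X (top_of_set U) f"

(* Measure zero under the identification of a linear map with the tuple of its l component
   functionals, i.e. with the rows of its matrix. *)
definition null_set_of_linear_maps :: "(real^'m \<Rightarrow> real^'l) set \<Rightarrow> bool" where
  "null_set_of_linear_maps \<Sigma> \<longleftrightarrow> matrix ` \<Sigma> \<in> null_sets lebesgue"

definition linear_perturbation ::
  "(real^'m \<Rightarrow> real^'l) \<Rightarrow> (real^'m \<Rightarrow> real^'l) \<Rightarrow> real^'m \<Rightarrow> real^'l" where
  "linear_perturbation F \<pi> = (\<lambda>x. F x + \<pi> x)"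

end

theory Submission
  imports Defs
begin

text \<open>
  Since N is compact, an injective immersion is an embedding, and finitely many charts suffice.
  Failure of injectivity at points with chart coordinates x, y, or of immersivity at x in direction
  u, is an equation M v(p) = w(p) for the matrix M of the perturbation, with a parameter p = (x, y)
  or p = (x, u) in a set of dimension 2n < l, and v(p) nonzero because f is an injective immersion.
  Where the j-th coordinate of v(p) is nonzero, M is determined by p and its columns other than j,
  so these M form a differentiable image of a set of dimension 2n + l(m - 1) < lm.
\<close>

section \<open>Matrices solving one of a family of linear equations\<close>

lemma bounded_bilinear_matrix_vector_mult:
  "bounded_bilinear ((*v) :: real^'m^'l \<Rightarrow> real^'m \<Rightarrow> real^'l)"
proof -
  have "bilinear ((*v) :: real^'m^'l \<Rightarrow> real^'m \<Rightarrow> real^'l)"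
    unfolding bilinear_def
    by (auto intro!: linearI simp: matrix_vector_mult_add_rdistrib matrix_vector_right_distrib
        matrix_vector_mult_scaleR scaleR_matrix_vector_assoc)
  then show ?thesis
    by (simp add: bilinear_conv_bounded_bilinear)
qed

lemma differentiable_bounded_bilinear:
  assumes "bounded_bilinear h"
    and "f differentiable (at x within S)" "g differentiable (at x within S)"
  shows "(\<lambda>x. h (f x) (g x)) differentiable (at x within S)"
  using assms bounded_bilinear.FDERIV unfolding differentiable_def by blast

text \<open>Instead of a product of the parameter space with the free columns, the space of matrices
  itself serves as the source. Since \<open>DIM('p) < CARD('l)\<close>, a parameter fits into column
  j with one dimension to spare, so the encoded data lie in a hyperplane, which is
  negligible.\<close>

lemma negligible_matrices_solving:
  fixes v :: "'p::euclidean_space \<Rightarrow> real^'m" and w :: "'p \<Rightarrow> real^'l"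
  assumes dim: "DIM('p) < CARD('l)"
    and v: "v differentiable_on \<Omega>" and w: "w differentiable_on \<Omega>"
    and nz: "\<And>p. p \<in> \<Omega> \<Longrightarrow> v p \<noteq> 0"
  shows "negligible {M :: real^'m^'l. \<exists>p\<in>\<Omega>. M *v v p = w p}"
proof -
  obtain h :: "'p \<Rightarrow> real^'l" where h: "linear h" "inj h"
  proof -
    have "dim (UNIV :: 'p set) \<le> dim (UNIV :: (real^'l) set)"
      using dim by simp
    from isometry_subset_subspace[OF subspace_UNIV subspace_UNIV this]
    obtain h :: "'p \<Rightarrow> real^'l" where "linear h" "\<And>x. norm (h x) = norm x"
      by auto
    then show thesis
      using that by (metis linear_injective_0 norm_eq_zero)
  qed
  obtain L where L: "linear L" "\<And>p. L (h p) = p"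
    using linear_injective_left_inverse[OF h] by (metis comp_apply id_apply)
  \<comment> \<open>The strict inequality of dimensions makes \<open>range h\<close> a proper
    subspace of \<open>real^'l\<close>; the nonzero vector \<open>a\<close> is normal to it.\<close>
  have "dim (range h) \<le> DIM('p)"
    using dim_image_le[OF h(1), of UNIV] by simp
  then have "dim (range h) < DIM(real^'l)"
    using dim by simp
  then obtain a :: "real^'l" where a: "a \<noteq> 0" "\<And>p. a \<bullet> h p = 0"
    using lowdim_subset_hyperplane[of "range h"] span_superset[of "range h"]
    by (smt (verit) mem_Collect_eq rangeI subset_iff)
  \<comment> \<open>Adding \<open>E j c\<close> changes column j by \<open>c\<close> and nothing
    else. Its inner product with a matrix sees only column j, so orthogonality to
    \<open>E j a\<close> is the hyperplane condition for column j.\<close>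
  define E :: "'m \<Rightarrow> real^'l \<Rightarrow> real^'m^'l"
    where "E j c = (\<chi> i k. if k = j then c $ i else 0)" for j c
  have E_lin: "linear (E j)" for j
    by (rule linearI) (auto simp: E_def vec_eq_iff)
  have E_mult: "E j c *v x = x $ j *\<^sub>R c" for j c x
    by (auto simp: E_def matrix_vector_mult_def vec_eq_iff if_distrib[of "\<lambda>t. t * _"] cong: if_cong)
  have E_inner: "E j c \<bullet> M = c \<bullet> column j M" for j c M
    by (auto simp: E_def inner_vec_def column_def if_distrib[of "\<lambda>t. t * _"] cong: if_cong)
  \<comment> \<open>The first condition places \<open>S j\<close> in a hyperplane, the second says
    that column j decodes to a parameter in \<open>\<Omega>\<close>, and the third permits the
    division by the j-th coordinate of \<open>v\<close>.\<close>
  define S where "S j = {M. E j a \<bullet> M = 0 \<and> L (column j M) \<in> \<Omega> \<and> v (L (column j M)) $ j \<noteq> 0}" for j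
  \<comment> \<open>The parameter p is stored in column j of M, which its equation then determines.\<close>
  define G where "G j M = M + E j ((1 / v (L (column j M)) $ j) *\<^sub>R
      (w (L (column j M)) - M *v v (L (column j M))))" for j M
  have "negligible (S j)" for j
  proof (rule negligible_subset)
    have "E j a \<noteq> 0"
      using a(1) by (auto simp: E_def vec_eq_iff)
    then show "negligible {M. E j a \<bullet> M = 0}"
      by (intro negligible_hyperplane) auto
  qed (auto simp: S_def)
  moreover have "G j differentiable_on S j" for j
    unfolding differentiable_on_def
  proof
    fix M assume M: "M \<in> S j"
    have lin: "linear (\<lambda>M. L (column j M))"
      by (rule linear_compose[OF _ L(1), unfolded o_def])
        (auto intro!: linearI simp: column_def vec_eq_iff)
    have p: "(\<lambda>M. L (column j M)) differentiable (at M within S j)"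
      using lin by (rule linear_imp_differentiable)
    have im: "(\<lambda>M. L (column j M)) ` S j \<subseteq> \<Omega>"
      by (auto simp: S_def)
    \<comment> \<open>\<open>v\<close> and \<open>w\<close> are differentiable only relative to
      \<open>\<Omega>\<close>, so the chain rule is applied within the image of \<open>S j\<close>
      under the decoding map, which lies in \<open>\<Omega>\<close>.\<close>
    have comp: "(\<lambda>M. q (L (column j M))) differentiable (at M within S j)"
      if "q differentiable_on \<Omega>" for q :: "'p \<Rightarrow> 'q::real_normed_vector"
    proof (rule differentiable_in_compose[OF _ p])
      show "q differentiable (at (L (column j M)) within (\<lambda>M. L (column j M)) ` S j)"
        using that M im by (meson differentiable_on_def differentiable_within_subset image_eqI subsetD)
    qed
    have vj: "(\<lambda>M. v (L (column j M)) $ j) differentiable (at M within S j)"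
      using differentiable_compose[of "\<lambda>x. x $ j" "\<lambda>M. v (L (column j M))", OF _ comp[OF v]]
      by (simp add: bounded_linear_imp_differentiable bounded_linear_vec_nth)
    have "(\<lambda>M. (1 / v (L (column j M)) $ j) *\<^sub>R
      (w (L (column j M)) - M *v v (L (column j M)))) differentiable (at M within S j)"
      using M
      by (intro differentiable_scaleR differentiable_divide differentiable_const vj
          differentiable_diff comp[OF w] differentiable_ident comp[OF v]
          differentiable_bounded_bilinear[OF bounded_bilinear_matrix_vector_mult])
        (auto simp: S_def)
    then have "(\<lambda>M. E j ((1 / v (L (column j M)) $ j) *\<^sub>R
      (w (L (column j M)) - M *v v (L (column j M))))) differentiable (at M within S j)"
      using differentiable_compose[OF linear_imp_differentiable[OF E_lin]] by blast
    then show "G j differentiable (at M within S j)"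
      unfolding G_def by (intro differentiable_add differentiable_ident)
  qed
  \<comment> \<open>Each \<open>G j\<close> maps the space of matrices to itself, so it sends
    negligible sets on which it is differentiable to negligible sets; there are finitely many
    columns j.\<close>
  ultimately have "negligible (\<Union>j. G j ` S j)"
    by (intro negligible_Union) (auto intro: negligible_differentiable_image_negligible)
  moreover have "{M. \<exists>p\<in>\<Omega>. M *v v p = w p} \<subseteq> (\<Union>j. G j ` S j)"
  proof clarify
    fix M p assume p: "p \<in> \<Omega>" and M: "M *v v p = w p"
    obtain j where j: "v p $ j \<noteq> 0"
      using nz[OF p] by (auto simp: vec_eq_iff)
    \<comment> \<open>\<open>M0\<close> is \<open>M\<close> with column j overwritten by the code of
      \<open>p\<close>. This shifts the product with \<open>v p\<close> by \<open>v p $ j\<close>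
      times the change of the column, so dividing the residual by \<open>v p $ j\<close> recovers
      the old column.\<close>
    define M0 where "M0 = M + E j (h p - column j M)"
    have col: "column j M0 = h p"
      by (auto simp: M0_def E_def column_def vec_eq_iff)
    have "M0 \<in> S j"
      using p j by (auto simp: S_def E_inner col L a)
    moreover have "G j M0 = M"
    proof -
      have "w p - M0 *v v p = - (v p $ j) *\<^sub>R (h p - column j M)"
        by (simp add: M0_def matrix_vector_mult_add_rdistrib M E_mult)
      then have "G j M0 = M0 + E j (- (h p - column j M))"
        using j by (simp add: G_def col L)
      also have "\<dots> = M"
        using linear_neg[OF E_lin, of j "h p - column j M"] by (simp add: M0_def)
      finally show ?thesis .
    qed
    ultimately show "M \<in> (\<Union>j. G j ` S j)"
      by blast
  qed
  ultimately show ?thesis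
    by (rule negligible_subset)
qed

section \<open>Calculus of C2 maps\<close>

lemma C2_on_imp_differentiable_at: "C2_on f S \<Longrightarrow> x \<in> S \<Longrightarrow> f differentiable (at x)"
  unfolding C2_on_def differentiable_def by blast

lemma C2_on_imp_differentiable_on: "C2_on f S \<Longrightarrow> f differentiable_on S"
  by (meson C2_on_imp_differentiable_at differentiable_at_withinI differentiable_on_def)

lemma C2_on_imp_continuous_on: "C2_on f S \<Longrightarrow> continuous_on S f"
  by (simp add: C2_on_imp_differentiable_on differentiable_imp_continuous_on)

lemma C2_on_compose:
  fixes f :: "'a::euclidean_space \<Rightarrow> 'b::real_normed_vector" and g :: "'b \<Rightarrow> 'c::real_normed_vector"
  assumes f: "C2_on f S" and g: "C2_on g T" and fS: "f ` S \<subseteq> T"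
  shows "C2_on (g \<circ> f) S"
proof -
  obtain f1 f2 where f1: "\<And>x. x \<in> S \<Longrightarrow> (f has_derivative blinfun_apply (f1 x)) (at x)"
    and f2: "\<And>x. x \<in> S \<Longrightarrow> (f1 has_derivative blinfun_apply (f2 x)) (at x)"
    and cf: "continuous_on S f2"
    using f unfolding C2_on_def by blast
  obtain g1 g2 where g1: "\<And>x. x \<in> T \<Longrightarrow> (g has_derivative blinfun_apply (g1 x)) (at x)"
    and g2: "\<And>x. x \<in> T \<Longrightarrow> (g1 has_derivative blinfun_apply (g2 x)) (at x)"
    and cg: "continuous_on T g2"
    using g unfolding C2_on_def by blast
  define h1 where "h1 x = g1 (f x) o\<^sub>L f1 x" for x
  \<comment> \<open>Product rule for \<open>h1\<close>: the first term differentiates the inner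
    derivative, the second the outer derivative along \<open>f\<close>.\<close>
  define D where "D x k = (g1 (f x) o\<^sub>L f2 x k) + (g2 (f x) (f1 x k) o\<^sub>L f1 x)" for x k
  have h1: "((g \<circ> f) has_derivative blinfun_apply (h1 x)) (at x)" if "x \<in> S" for x
  proof -
    have "f x \<in> T"
      using fS that by auto
    then show ?thesis
      using diff_chain_at[OF f1[OF that] g1] by (simp add: h1_def blinfun_compose.rep_eq)
  qed
  have D: "(h1 has_derivative D x) (at x)" if x: "x \<in> S" for x
  proof -
    have "((\<lambda>x. g1 (f x)) has_derivative (\<lambda>k. g2 (f x) (f1 x k))) (at x)"
      using diff_chain_at[OF f1[OF x] g2[of "f x"]] fS x by (auto simp: o_def)
    from bounded_bilinear.FDERIV[OF bounded_bilinear_blinfun_compose this f2[OF x]]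
    show ?thesis
      unfolding h1_def D_def .
  qed
  \<comment> \<open>On \<open>S\<close> the map \<open>D x\<close> is a derivative, hence bounded
    linear, so \<open>Blinfun\<close> packages it faithfully there.\<close>
  define h2 where "h2 x = Blinfun (D x)" for x
  have h2: "blinfun_apply (h2 x) = D x" if "x \<in> S" for x
    unfolding h2_def using D[OF that]
    by (simp add: bounded_linear_Blinfun_apply has_derivative_bounded_linear)
  have cont_f: "continuous_on S f"
    using C2_on_imp_continuous_on[OF f] .
  have cont_f1: "continuous_on S f1"
    by (rule has_derivative_continuous_on[OF has_derivative_at_withinI[OF f2]])
  have cont_g1: "continuous_on T g1"
    by (rule has_derivative_continuous_on[OF has_derivative_at_withinI[OF g2]])
  have cont: "continuous_on S (\<lambda>x. D x k)" for k
  proof -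
    have 1: "continuous_on S (\<lambda>x. g1 (f x))" "continuous_on S (\<lambda>x. g2 (f x))"
      using continuous_on_compose2[OF cont_g1 cont_f fS] continuous_on_compose2[OF cg cont_f fS] .
    show ?thesis
      unfolding D_def
      by (intro continuous_on_add 1 cf cont_f1 continuous_on_const
          bounded_bilinear.continuous_on[OF bounded_bilinear_blinfun_compose]
          bounded_bilinear.continuous_on[OF bounded_bilinear_blinfun_apply])
  qed
  \<comment> \<open>The domain is finite-dimensional, so convergence in operator norm follows from
    convergence on each basis vector, and \<open>cont\<close> gives it for every vector
    \<open>k\<close>.\<close>
  have "continuous_on S h2"
    unfolding continuous_on_def
  proof (rule ballI, rule tendsto_componentwise1)
    fix x k assume x: "x \<in> S"
    have "continuous_on S (\<lambda>x. h2 x k)"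
      using cont[of k] h2 by (simp cong: continuous_on_cong)
    then show "((\<lambda>y. h2 y k) \<longlongrightarrow> h2 x k) (at x within S)"
      using x by (simp add: continuous_on_def)
  qed
  moreover have "(h1 has_derivative blinfun_apply (h2 x)) (at x)" if "x \<in> S" for x
    using D[OF that] h2[OF that] by simp
  ultimately show ?thesis
    unfolding C2_on_def using h1 by blast
qed

lemma C2_on_linear_perturbation:
  assumes F: "C2_on F U" and \<pi>: "linear \<pi>"
  shows "C2_on (linear_perturbation F \<pi>) U"
proof -
  obtain F1 F2 where F1: "\<And>x. x \<in> U \<Longrightarrow> (F has_derivative blinfun_apply (F1 x)) (at x)"
    and F2: "\<And>x. x \<in> U \<Longrightarrow> (F1 has_derivative blinfun_apply (F2 x)) (at x)"
    and cont: "continuous_on U F2"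
    using F unfolding C2_on_def by blast
  have bl: "bounded_linear \<pi>"
    using \<pi> by (simp add: linear_conv_bounded_linear)
  have "(linear_perturbation F \<pi> has_derivative blinfun_apply (F1 x + Blinfun \<pi>)) (at x)" if "x \<in> U" for x
    using has_derivative_add[OF F1[OF that] bounded_linear_imp_has_derivative[OF bl]]
    by (simp add: linear_perturbation_def[abs_def] plus_blinfun.rep_eq bounded_linear_Blinfun_apply[OF bl])
  moreover have "((\<lambda>x. F1 x + Blinfun \<pi>) has_derivative blinfun_apply (F2 x)) (at x)" if "x \<in> U" for x
    using has_derivative_add[OF F2[OF that] has_derivative_const] by simp
  ultimately show ?thesis
    unfolding C2_on_def using cont by (intro exI[of _ "\<lambda>x. F1 x + Blinfun \<pi>"] exI[of _ F2]) auto
qed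

section \<open>Perturbations that fail in given charts\<close>

lemma C2_on_derivativeE:
  assumes "C2_on f S"
  obtains f1 where "\<And>x. x \<in> S \<Longrightarrow> (f has_derivative blinfun_apply (f1 x)) (at x)"
    and "(\<lambda>p. blinfun_apply (f1 (fst p)) (snd p)) differentiable_on S \<times> T"
proof -
  obtain f1 f2 where f1: "\<And>x. x \<in> S \<Longrightarrow> (f has_derivative blinfun_apply (f1 x)) (at x)"
    and f2: "\<And>x. x \<in> S \<Longrightarrow> (f1 has_derivative blinfun_apply (f2 x)) (at x)"
    using assms unfolding C2_on_def by blast
  \<comment> \<open>Second derivatives enter the measure argument here: as \<open>f1\<close> is
    itself differentiable, the directional derivative is jointly differentiable in base point and
    direction.\<close>
  have "(\<lambda>p. blinfun_apply (f1 (fst p)) (snd p)) differentiable_on S \<times> T"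
    unfolding differentiable_on_def
  proof
    fix p assume "p \<in> S \<times> T"
    then have "f1 differentiable (at (fst p))"
      using f2 unfolding differentiable_def by (cases p) auto
    then have "(\<lambda>p. f1 (fst p)) differentiable (at p within S \<times> T)"
      by (rule differentiable_compose[OF _ bounded_linear_imp_differentiable[OF bounded_linear_fst]])
    then show "(\<lambda>p. blinfun_apply (f1 (fst p)) (snd p)) differentiable (at p within S \<times> T)"
      by (rule differentiable_bounded_bilinear[OF bounded_bilinear_blinfun_apply _
            bounded_linear_imp_differentiable[OF bounded_linear_snd]])
  qed
  with f1 show thesis
    by (rule that)
qed

text \<open>By linearity, failure of injectivity means a nonzero kernel vector u of the derivative
  at x. Letting u range over all nonzero vectors, without normalising, gives parameters (x, u) in a
  space of dimension 2n; the coefficient \<open>g1 x u\<close> is nonzero because \<open>g\<close>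
  is an immersion.\<close>

lemma negligible_not_immersion:
  fixes g :: "real^'n \<Rightarrow> real^'m" and F :: "real^'m \<Rightarrow> real^'l"
  assumes g: "C2_on g S" and F: "C2_on F U" and gS: "g ` S \<subseteq> U"
    and inj: "\<And>x. x \<in> S \<Longrightarrow> inj (frechet_derivative g (at x))"
    and dim: "2 * CARD('n) < CARD('l)"
  shows "negligible {M :: real^'m^'l. \<exists>x\<in>S.
    \<not> inj (frechet_derivative (linear_perturbation F ((*v) M) \<circ> g) (at x))}"
proof -
  obtain g1 where g1: "\<And>x. x \<in> S \<Longrightarrow> (g has_derivative blinfun_apply (g1 x)) (at x)"
    and dg: "(\<lambda>p. blinfun_apply (g1 (fst p)) (snd p)) differentiable_on S \<times> (- {0})"
    using C2_on_derivativeE[OF g] by blast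
  obtain h1 where h1: "\<And>x. x \<in> S \<Longrightarrow> ((F \<circ> g) has_derivative blinfun_apply (h1 x)) (at x)"
    and dh: "(\<lambda>p. blinfun_apply (h1 (fst p)) (snd p)) differentiable_on S \<times> (- {0})"
    using C2_on_derivativeE[OF C2_on_compose[OF g F gS]] by blast
  have deriv: "frechet_derivative (linear_perturbation F ((*v) M) \<circ> g) (at x) =
      (\<lambda>u. h1 x u + M *v g1 x u)" if "x \<in> S" for M :: "real^'m^'l" and x
  proof -
    have "((\<lambda>y. M *v g y) has_derivative (\<lambda>u. M *v g1 x u)) (at x)"
      by (intro bounded_linear.has_derivative[OF _ g1[OF that]]
          bounded_bilinear.bounded_linear_right[OF bounded_bilinear_matrix_vector_mult])
    then have "((linear_perturbation F ((*v) M) \<circ> g) has_derivative (\<lambda>u. h1 x u + M *v g1 x u)) (at x)"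
      using has_derivative_add[OF h1[OF that]]
      by (simp add: linear_perturbation_def o_def)
    then show ?thesis
      by (rule frechet_derivative_at[symmetric])
  qed
  have "negligible {M :: real^'m^'l. \<exists>p\<in>S \<times> (- {0}). M *v g1 (fst p) (snd p) = - h1 (fst p) (snd p)}"
  proof (rule negligible_matrices_solving[OF _ dg])
    show "DIM((real^'n) \<times> (real^'n)) < CARD('l)"
      using dim by simp
    show "(\<lambda>p. - blinfun_apply (h1 (fst p)) (snd p)) differentiable_on S \<times> (- {0})"
      using dh by (rule differentiable_on_minus)
    fix p :: "(real^'n) \<times> (real^'n)" assume p: "p \<in> S \<times> (- {0})"
    then have "inj (blinfun_apply (g1 (fst p)))"
      using inj[of "fst p"] frechet_derivative_at[OF g1] by auto
    then show "blinfun_apply (g1 (fst p)) (snd p) \<noteq> 0"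
      using p by (metis ComplD SigmaE blinfun.zero_right injD insertI1 snd_conv)
  qed
  then show ?thesis
  proof (rule negligible_subset, clarify)
    fix M :: "real^'m^'l" and x
    assume x: "x \<in> S" and ninj: "\<not> inj (frechet_derivative (linear_perturbation F ((*v) M) \<circ> g) (at x))"
    have "linear (\<lambda>u. h1 x u + M *v g1 x u)"
      by (rule linearI) (simp_all add: blinfun.add_right blinfun.scaleR_right
          matrix_vector_right_distrib matrix_vector_mult_scaleR scaleR_add_right)
    then obtain u where "u \<noteq> 0" "h1 x u + M *v g1 x u = 0"
      using ninj by (auto simp: deriv[OF x] linear_injective_0)
    then show "\<exists>p\<in>S \<times> (- {0}). M *v g1 (fst p) (snd p) = - h1 (fst p) (snd p)"
      using x by (intro bexI[of _ "(x, u)"]) (auto simp: eq_neg_iff_add_eq_0 add.commute)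
  qed
qed

text \<open>Rearranging the collision gives M (g x - g' y) = F (g' y) - F (g x). Two
  parametrisations are allowed because colliding points may lie in different charts; requiring
  \<open>g x \<noteq> g' y\<close> makes the coefficient of M nonzero and discards pairs that
  describe the same point.\<close>

lemma negligible_not_injective:
  fixes g :: "real^'n \<Rightarrow> real^'m" and g' :: "real^'n \<Rightarrow> real^'m" and F :: "real^'m \<Rightarrow> real^'l"
  assumes g: "g differentiable_on S" and g': "g' differentiable_on S'"
    and F: "F differentiable_on U" and gS: "g ` S \<subseteq> U" and gS': "g' ` S' \<subseteq> U"
    and dim: "2 * CARD('n) < CARD('l)"
  shows "negligible {M :: real^'m^'l. \<exists>x\<in>S. \<exists>y\<in>S'. g x \<noteq> g' y \<and>
    linear_perturbation F ((*v) M) (g x) = linear_perturbation F ((*v) M) (g' y)}"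
proof -
  define \<Omega> where "\<Omega> = {p \<in> S \<times> S'. g (fst p) \<noteq> g' (snd p)}"
  have 1: "(\<lambda>p. q (fst p)) differentiable_on \<Omega>" if "q differentiable_on S"
    for q :: "real^'n \<Rightarrow> 'q::real_normed_vector"
    by (rule differentiable_on_compose[of fst \<Omega> q, unfolded o_def])
      (auto intro!: bounded_linear_imp_differentiable_on bounded_linear_fst
        differentiable_on_subset[OF that] simp: \<Omega>_def)
  have 2: "(\<lambda>p. q (snd p)) differentiable_on \<Omega>" if "q differentiable_on S'"
    for q :: "real^'n \<Rightarrow> 'q::real_normed_vector"
    by (rule differentiable_on_compose[of snd \<Omega> q, unfolded o_def])
      (auto intro!: bounded_linear_imp_differentiable_on bounded_linear_snd
        differentiable_on_subset[OF that] simp: \<Omega>_def)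
  have Fg: "(\<lambda>x. F (g x)) differentiable_on S" "(\<lambda>x. F (g' x)) differentiable_on S'"
    using differentiable_on_compose[OF g differentiable_on_subset[OF F gS]]
      differentiable_on_compose[OF g' differentiable_on_subset[OF F gS']] by (auto simp: o_def)
  have "negligible {M :: real^'m^'l. \<exists>p\<in>\<Omega>. M *v (g (fst p) - g' (snd p)) = F (g' (snd p)) - F (g (fst p))}"
  proof (rule negligible_matrices_solving)
    show "DIM((real^'n) \<times> (real^'n)) < CARD('l)"
      using dim by simp
    show "(\<lambda>p. g (fst p) - g' (snd p)) differentiable_on \<Omega>"
      by (intro differentiable_on_diff 1[OF g] 2[OF g'])
    show "(\<lambda>p. F (g' (snd p)) - F (g (fst p))) differentiable_on \<Omega>"
      by (intro differentiable_on_diff 1[OF Fg(1)] 2[OF Fg(2)])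
  qed (auto simp: \<Omega>_def)
  then show ?thesis
  proof (rule negligible_subset, clarify)
    fix M :: "real^'m^'l" and x y
    assume "x \<in> S" "y \<in> S'" "g x \<noteq> g' y"
      and "linear_perturbation F ((*v) M) (g x) = linear_perturbation F ((*v) M) (g' y)"
    then show "\<exists>p\<in>\<Omega>. M *v (g (fst p) - g' (snd p)) = F (g' (snd p)) - F (g (fst p))"
      by (intro bexI[of _ "(x, y)"])
        (auto simp: \<Omega>_def linear_perturbation_def matrix_vector_mult_diff_distrib algebra_simps)
  qed
qed

section \<open>Charts and changes of chart\<close>

lemma is_chart_inj_on: "is_chart X (V, \<phi>) \<Longrightarrow> inj_on \<phi> V"
  unfolding is_chart_def
  by (auto dest!: homeomorphic_imp_injective_map openin_subset simp: Int_absorb1)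

lemma is_chart_openin_subset: "is_chart X (V, \<phi>) \<Longrightarrow> openin X V \<and> V \<subseteq> topspace X"
  unfolding is_chart_def by (auto dest: openin_subset)

lemma is_chart_open_image:
  assumes c: "is_chart X (V, \<phi>)" and W: "openin X W" "W \<subseteq> V"
  shows "open (\<phi> ` W)"
proof -
  have hom: "homeomorphic_map (subtopology X V) (top_of_set (\<phi> ` V)) \<phi>" and "open (\<phi> ` V)"
    using c by (auto simp: is_chart_def)
  have "openin (subtopology X V) W"
    using W openin_subtopology_Int2[of X W V] by (simp add: Int_absorb1)
  then have "openin (top_of_set (\<phi> ` V)) (\<phi> ` W)"
    using homeomorphic_map_openness[OF hom openin_subset] by blast
  then show ?thesis
    using \<open>open (\<phi> ` V)\<close> openin_open_trans by blast
qed

text \<open>The bad set is built from finitely many charts, whereas an immersion is tested in every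
  chart of the atlas; this lemma transfers the test. Near p the two local expressions differ by a
  transition map with injective derivative.\<close>

lemma inj_frechet_derivative_chart_change:
  assumes man: "C2_manifold X A" and c: "(V, \<phi>) \<in> A" "(W, \<psi>) \<in> A"
    and p: "p \<in> V" "p \<in> W"
    and diff: "(h \<circ> inv_into W \<psi>) differentiable (at (\<psi> p))"
    and inj: "inj (frechet_derivative (h \<circ> inv_into W \<psi>) (at (\<psi> p)))"
  shows "inj (frechet_derivative (h \<circ> inv_into V \<phi>) (at (\<phi> p)))"
proof -
  have charts: "is_chart X (V, \<phi>)" "is_chart X (W, \<psi>)"
    using man c by (auto simp: C2_manifold_def)
  note injs = charts[THEN is_chart_inj_on]
  \<comment> \<open>The local expressions are compared only on the overlap; its openness is what
    makes agreement there determine derivatives at \<open>\<phi> p\<close>.\<close>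
  have op: "open (\<phi> ` (V \<inter> W))"
    using charts is_chart_openin_subset is_chart_open_image[OF charts(1), of "V \<inter> W"] by blast
  define \<tau> where "\<tau> = \<psi> \<circ> inv_into V \<phi>"
  define \<sigma> where "\<sigma> = \<phi> \<circ> inv_into W \<psi>"
  have "C2_on \<tau> (\<phi> ` (V \<inter> W))" "C2_on \<sigma> (\<psi> ` (W \<inter> V))"
    using man c unfolding C2_manifold_def \<tau>_def \<sigma>_def by fastforce+
  then have "\<tau> differentiable (at (\<phi> p))" "\<sigma> differentiable (at (\<psi> p))"
    using C2_on_imp_differentiable_at p by blast+
  then obtain \<tau>' \<sigma>' where \<tau>': "(\<tau> has_derivative \<tau>') (at (\<phi> p))"
    and \<sigma>': "(\<sigma> has_derivative \<sigma>') (at (\<psi> p))"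
    unfolding differentiable_def by blast
  have \<tau>p: "\<tau> (\<phi> p) = \<psi> p"
    using p injs by (simp add: \<tau>_def)
  have "((\<sigma> \<circ> \<tau>) has_derivative (\<sigma>' \<circ> \<tau>')) (at (\<phi> p))"
    using diff_chain_at[OF \<tau>'] \<sigma>' \<tau>p by simp
  moreover have "(\<sigma> \<circ> \<tau>) x = id x" if "x \<in> \<phi> ` (V \<inter> W)" for x
    using that injs by (auto simp: \<sigma>_def \<tau>_def)
  ultimately have "(id has_derivative (\<sigma>' \<circ> \<tau>')) (at (\<phi> p))"
    using has_derivative_transform_within_open[OF _ op, of "\<sigma> \<circ> \<tau>" _ "\<phi> p" UNIV id] p by auto
  \<comment> \<open>The transition maps are mutually inverse on the overlap, so
    \<open>\<sigma>'\<close> is a left inverse of \<open>\<tau>'\<close>.\<close>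
  then have "\<sigma>' \<circ> \<tau>' = id"
    using has_derivative_unique[OF _ has_derivative_id] by (auto simp: id_def)
  then have "inj \<tau>'"
    using inj_on_imageI2[of \<sigma>' \<tau>' UNIV] by simp
  define h' where "h' = frechet_derivative (h \<circ> inv_into W \<psi>) (at (\<psi> p))"
  have h': "((h \<circ> inv_into W \<psi>) has_derivative h') (at (\<psi> p))"
    using diff by (simp add: h'_def frechet_derivative_works)
  have "(((h \<circ> inv_into W \<psi>) \<circ> \<tau>) has_derivative (h' \<circ> \<tau>')) (at (\<phi> p))"
    using diff_chain_at[OF \<tau>'] h' \<tau>p by simp
  moreover have "((h \<circ> inv_into W \<psi>) \<circ> \<tau>) x = (h \<circ> inv_into V \<phi>) x" if "x \<in> \<phi> ` (V \<inter> W)" for x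
    using that injs by (auto simp: \<tau>_def)
  ultimately have "((h \<circ> inv_into V \<phi>) has_derivative (h' \<circ> \<tau>')) (at (\<phi> p))"
    using has_derivative_transform_within_open[OF _ op, of "(h \<circ> inv_into W \<psi>) \<circ> \<tau>" _ "\<phi> p" UNIV] p by auto
  then have "frechet_derivative (h \<circ> inv_into V \<phi>) (at (\<phi> p)) = h' \<circ> \<tau>'"
    by (rule frechet_derivative_at[symmetric])
  then show ?thesis
    using \<open>inj \<tau>'\<close> inj by (simp add: h'_def inj_compose)
qed

text \<open>An atlas may be uncountable, and a union of negligible sets over all its charts could
  then fail to be negligible; compactness reduces the union to a finite one.\<close>

lemma C2_manifold_compact_finite_atlas:
  assumes man: "C2_manifold X A" and "compact_space X"
  obtains A0 where "finite A0" "A0 \<subseteq> A" "(\<Union>(V, \<phi>)\<in>A0. V) = topspace X"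
proof -
  have "\<forall>V \<in> fst ` A. openin X V"
    using man by (auto simp: C2_manifold_def is_chart_def)
  moreover have "\<Union>(fst ` A) = topspace X"
    using man by (auto simp: C2_manifold_def case_prod_unfold)
  ultimately obtain \<F> where \<F>: "finite \<F>" "\<F> \<subseteq> fst ` A" "\<Union>\<F> = topspace X"
    using \<open>compact_space X\<close> unfolding compact_space by meson
  then obtain A0 where "A0 \<subseteq> A" "finite A0" "\<F> = fst ` A0"
    by (meson finite_subset_image)
  with \<F> show thesis
    by (intro that[of A0]) (auto simp: case_prod_unfold)
qed

section \<open>The exceptional set on the compact manifold\<close>

theorem corollary7:
  fixes N :: "'a topology"
    and A :: "('a, 'n::finite) chart set"
    and U :: "(real^'m) set"
    and f :: "'a \<Rightarrow> real^'m"
    and F :: "real^'m \<Rightarrow> real^'l"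
  assumes "C2_manifold N A"
    and "compact_space N"
    and "open U"
    and "C2_embedding N A U f"
    and "C2_on F U"
    and "CARD('l) > 2 * CARD('n)"
  shows "\<exists>\<Sigma> \<subseteq> {\<pi>. linear \<pi>}. null_set_of_linear_maps \<Sigma> \<and>
    (\<forall>\<pi> \<in> {\<pi>. linear \<pi>} - \<Sigma>.
      C2_embedding N A UNIV (linear_perturbation F \<pi> \<circ> f))"
proof -
  obtain A0 where A0: "finite A0" "A0 \<subseteq> A" "(\<Union>(V, \<phi>)\<in>A0. V) = topspace N"
    using C2_manifold_compact_finite_atlas[OF assms(1,2)] .
  have cover: "\<exists>V \<phi>. (V, \<phi>) \<in> A0 \<and> p \<in> V" if "p \<in> topspace N" for p
    using that unfolding A0(3)[symmetric] by auto
  have chart: "is_chart N (V, \<phi>)" if "(V, \<phi>) \<in> A" for V \<phi>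
    using assms(1) that by (auto simp: C2_manifold_def)
  have fU: "f ` topspace N \<subseteq> U"
    and fC2: "\<And>V \<phi>. (V, \<phi>) \<in> A \<Longrightarrow> C2_on (f \<circ> inv_into V \<phi>) (\<phi> ` V)"
    and fimm: "\<And>V \<phi> p. (V, \<phi>) \<in> A \<Longrightarrow> p \<in> V \<Longrightarrow>
      inj (frechet_derivative (f \<circ> inv_into V \<phi>) (at (\<phi> p)))"
    and femb: "embedding_map N (top_of_set U) f"
    using assms(4) by (auto simp: C2_embedding_def C2_immersion_def C2_map_def)
  have finj: "inj_on f (topspace N)"
    using femb by (auto simp: embedding_map_def dest: homeomorphic_imp_injective_map)
  have fcont: "continuous_map N (top_of_set U) f"
    using femb unfolding embedding_map_def
    by (meson continuous_map_in_subtopology homeomorphic_imp_continuous_map)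
  have local_image: "(f \<circ> inv_into V \<phi>) ` \<phi> ` V \<subseteq> U" if "(V, \<phi>) \<in> A" for V \<phi>
    using fU is_chart_openin_subset[OF chart[OF that]] is_chart_inj_on[OF chart[OF that]]
    by (auto simp: image_subset_iff subset_iff)
  define P where "P M = linear_perturbation F ((*v) M)" for M :: "real^'m^'l"
  define crit where "crit = (\<lambda>(V, \<phi> :: 'a \<Rightarrow> real^'n). {M. \<exists>x\<in>\<phi> ` V.
      \<not> inj (frechet_derivative (P M \<circ> (f \<circ> inv_into V \<phi>)) (at x))})"
  \<comment> \<open>Distinct points are recognised by their distinct images under \<open>f\<close>,
    which is injective, so a point lying in two charts does not count as a collision.\<close>
  define double where "double = (\<lambda>((V, \<phi> :: 'a \<Rightarrow> real^'n), (W, \<psi> :: 'a \<Rightarrow> real^'n)).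
      {M. \<exists>x\<in>\<phi> ` V. \<exists>y\<in>\<psi> ` W.
      (f \<circ> inv_into V \<phi>) x \<noteq> (f \<circ> inv_into W \<psi>) y \<and>
      P M ((f \<circ> inv_into V \<phi>) x) = P M ((f \<circ> inv_into W \<psi>) y)})"
  define B where "B = \<Union>(crit ` A0) \<union> \<Union>(double ` (A0 \<times> A0))"
  have "negligible (crit c)" if "c \<in> A0" for c
  proof (cases c)
    case (Pair V \<phi>)
    with that A0(2) have c: "(V, \<phi>) \<in> A"
      by auto
    then show ?thesis
      unfolding crit_def Pair P_def case_prod_conv
      by (intro negligible_not_immersion[OF fC2 assms(5) local_image _ assms(6)])
        (auto simp: fimm)
  qed
  moreover have "negligible (double d)" if "d \<in> A0 \<times> A0" for d
  proof -
    obtain V \<phi> W \<psi> where d: "d = ((V, \<phi>), (W, \<psi>))"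
      by (metis surj_pair)
    with that A0(2) have c: "(V, \<phi>) \<in> A" "(W, \<psi>) \<in> A"
      by auto
    then show ?thesis
      unfolding double_def d P_def case_prod_conv
      by (intro negligible_not_injective[OF _ _ _ local_image local_image assms(6)]
          C2_on_imp_differentiable_on fC2 assms(5))
  qed
  ultimately have "negligible B"
    unfolding B_def using A0(1) by (intro negligible_Un negligible_Union) auto
  have good: "C2_embedding N A UNIV (linear_perturbation F \<pi> \<circ> f)"
    if \<pi>: "linear \<pi>" and nB: "matrix \<pi> \<notin> B" for \<pi>
  proof -
    \<comment> \<open>A linear map is multiplication by its own matrix, so avoiding \<open>B\<close>
      is a condition on \<open>\<pi>\<close> itself.\<close>
    have P: "linear_perturbation F \<pi> = P (matrix \<pi>)"
      using \<pi> by (simp add: P_def)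
    let ?G = "P (matrix \<pi>)"
    have G: "C2_on ?G U"
      using C2_on_linear_perturbation[OF assms(5) \<pi>] P by simp
    have C2: "C2_on (?G \<circ> f \<circ> inv_into V \<phi>) (\<phi> ` V)" if "(V, \<phi>) \<in> A" for V \<phi>
      using C2_on_compose[OF fC2 G local_image] that by (simp add: o_assoc)
    have imm: "inj (frechet_derivative (?G \<circ> f \<circ> inv_into V \<phi>) (at (\<phi> p)))"
      if c: "(V, \<phi>) \<in> A" and p: "p \<in> V" for V \<phi> p
    proof -
      have "p \<in> topspace N"
        using is_chart_openin_subset[OF chart[OF c]] p by auto
      \<comment> \<open>The chart at hand may lie outside \<open>A0\<close>, so injectivity of the
        derivative is read off in a chart of \<open>A0\<close> around p and carried over.\<close>
      then obtain W \<psi> where W: "(W, \<psi>) \<in> A0" "p \<in> W"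
        using cover by blast
      then have "matrix \<pi> \<notin> crit (W, \<psi>)"
        using nB by (auto simp: B_def)
      then have "inj (frechet_derivative (?G \<circ> f \<circ> inv_into W \<psi>) (at (\<psi> p)))"
        using W(2) by (auto simp: crit_def o_assoc)
      moreover have "(?G \<circ> f \<circ> inv_into W \<psi>) differentiable (at (\<psi> p))"
        using C2_on_imp_differentiable_at[OF C2] W A0(2) by blast
      ultimately show ?thesis
        using inj_frechet_derivative_chart_change[OF assms(1) c, of W \<psi> p] W A0(2) p by auto
    qed
    have "inj_on (?G \<circ> f) (topspace N)"
    proof (rule inj_onI, rule ccontr)
      fix p q assume p: "p \<in> topspace N" and q: "q \<in> topspace N"
        and eq: "(?G \<circ> f) p = (?G \<circ> f) q" and "p \<noteq> q"
      obtain V \<phi> W \<psi> where V: "(V, \<phi>) \<in> A0" "p \<in> V" and W: "(W, \<psi>) \<in> A0" "q \<in> W"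
        using cover[OF p] cover[OF q] by blast
      have "inv_into V \<phi> (\<phi> p) = p" "inv_into W \<psi> (\<psi> q) = q"
        using V W A0(2) is_chart_inj_on[OF chart] by auto
      moreover have "f p \<noteq> f q"
        using finj p q \<open>p \<noteq> q\<close> by (auto dest: inj_onD)
      ultimately have "matrix \<pi> \<in> double ((V, \<phi>), (W, \<psi>))"
        using V W eq unfolding double_def case_prod_conv mem_Collect_eq
        by (intro bexI[of _ "\<phi> p"] bexI[of _ "\<psi> q"]) simp_all
      then show False
        using V W nB by (auto simp: B_def)
    qed
    moreover have cont: "continuous_map N euclidean (?G \<circ> f)"
      by (rule continuous_map_compose[OF fcont]) (simp add: C2_on_imp_continuous_on[OF G])
    \<comment> \<open>A continuous map from a compact space to a Hausdorff space is closed, and an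
      injective continuous closed map is a topological embedding.\<close>
    ultimately have "embedding_map N euclidean (?G \<circ> f)"
      using continuous_imp_closed_map[OF cont assms(2)]
      by (intro injective_closed_imp_embedding_map) auto
    then show ?thesis
      using C2 imm unfolding P C2_embedding_def C2_immersion_def C2_map_def by auto
  qed
  let ?\<Sigma> = "{\<pi>. linear \<pi> \<and> matrix \<pi> \<in> B}"
  have "negligible (matrix ` ?\<Sigma>)"
    using \<open>negligible B\<close> by (rule negligible_subset) auto
  then have "null_set_of_linear_maps ?\<Sigma>"
    by (simp add: null_set_of_linear_maps_def negligible_iff_null_sets)
  with good show ?thesis
    by (intro exI[of _ ?\<Sigma>]) auto
qed

end
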